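(* Let $d,n$ be positive integers with $d\le n$. Then $\mathcal{C}_d\subseteq\mathbb{Z}_{2^n}$ is $d$-cube-free, and every $d$-cube-free set $S\subseteq\mathbb{Z}_{2^n}$ that is a union of some of the layers $L_1,\dots,L_{n+1}$ satisfies $|S|\le|\mathcal{C}_d|$.
   Context: All arithmetic is in $\mathbb{Z}_{2^n}$. For a multiset $S=\{a_1,\dots,a_d\}$ of $d$ (not necessarily distinct) elements, $\Sigma^*S=\{\sum_{i\in I}a_i:\emptyset\ne I\subseteq[d]\}$ (as a set) is the projective $d$-cube it generates; a set $A$ is $d$-cube-free if there is no multiset $S$ of size $d$ with $\Sigma^*S\subseteq A$. Layers: for $1\le i\le n$, $L_i=\{x\in\mathbb{Z}_{2^n}: x\equiv 2^{i-1}\pmod{2^i}\}$, $L_{n+1}=\{0\}$. Construction: define index sets $I_d\subseteq\mathbb{Z}_{>0}$ recursively by $I_1=\emptyset$ and, for $d\ge2$, with $\ell$ the largest integer such that $2^\ell\le d$, $I_d=\{1,\dots,\ell\}\cup\{j+\ell+1: j\in I_{d-2^\ell+1}\}$. Then $\mathcal{C}_d=\bigcup_{i\in I_d}L_i$ (for $d\le n$ all indices in $I_d$ are at most $n$). Equivalently, $\mathcal{C}_1=\emptyset$ and $\mathcal{C}_d=L_1\cup\dots\cup L_\ell\cup\{2^{\ell+1}x: x\in\mathcal{C}_{d-2^\ell+1}\}$. *)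

theory Defs
  imports Main "HOL-Library.Multiset" "HOL-Library.Discrete_Functions"
begin

text \<open>Z_{2^n} is represented by the residues {0..<2^n} (type nat), with
  addition taken mod 2^n.\<close>

definition proj_cube :: "nat \<Rightarrow> nat multiset \<Rightarrow> nat set" where
  "proj_cube n S = {sum_mset T mod 2 ^ n | T. T \<subseteq># S \<and> T \<noteq> {#}}"

definition cube_free :: "nat \<Rightarrow> nat \<Rightarrow> nat set \<Rightarrow> bool" where
  "cube_free n d A \<longleftrightarrow>
     \<not> (\<exists>S. size S = d \<and> set_mset S \<subseteq> {..<2 ^ n} \<and> proj_cube n S \<subseteq> A)"

definition layer :: "nat \<Rightarrow> nat \<Rightarrow> nat set" where
  "layer n i = (if 1 \<le> i \<and> i \<le> n then {x. x < 2 ^ n \<and> x mod 2 ^ i = 2 ^ (i - 1)}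
                else if i = n + 1 then {0} else {})"

function idx :: "nat \<Rightarrow> nat set" where
  "idx d = (if d < 2 then {}
            else {1..floor_log d} \<union> (\<lambda>j. j + floor_log d + 1) ` idx (d - 2 ^ floor_log d + 1))"
  by auto
termination
proof (relation "measure id")
  fix d :: nat
  assume "\<not> d < 2"
  then have l: "floor_log d = Suc (floor_log (d div 2))" by (intro floor_log_rec) simp
  have "2 ^ floor_log d \<ge> (2::nat)" unfolding l by simp
  moreover have "2 ^ floor_log d \<le> d" using floor_log_exp2_le \<open>\<not> d < 2\<close> by simp
  ultimately show "(d - 2 ^ floor_log d + 1, d) \<in> measure id" by simp
qed auto

definition cube_constr :: "nat \<Rightarrow> nat \<Rightarrow> nat set" where
  "cube_constr n d = (\<Union>i\<in>idx d. layer n i)"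

end

theory Submission
  imports Defs
begin

text \<open>Write \<open>m = 2 ^ l\<close>. If no subset sum of \<open>S\<close> is congruent to \<open>m\<close> modulo \<open>2 * m\<close>, then \<open>S\<close> contains
  at least \<open>size S - m + 1\<close> disjoint non-empty parts whose sums vanish modulo \<open>2 * m\<close>: split off
  minimal zero-sum parts until a zero-sum free rest remains, and add up (modulo \<open>2 * m\<close>) the sets of
  partial sums of all the pieces. By a Kneser-type bound the resulting set \<open>P\<close> has at least
  \<open>size S + 1\<close> minus the number of parts elements. The complement of a block in a zero-sum part has the
  opposite sum, so each difference in \<open>P\<close> is up to sign a subset sum of \<open>S\<close>; hence no two elements of
  \<open>P\<close> differ by \<open>m\<close>, and \<open>card P \<le> m\<close>. Dividing the sums of the parts by \<open>2 * m\<close> and recursing shows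
  that the construction is cube-free.

  Conversely, a union of layers containing \<open>L\<^sub>1, \<dots>, L\<^sub>l\<close> but not \<open>L\<^sub>l\<^sub>+\<^sub>1\<close> contains the cube on \<open>2 ^ l - 1\<close>
  ones together with \<open>2 ^ (l + 1)\<close> times any cube in the remaining layers. As \<open>L\<^sub>i\<close> is larger than
  the union of \<open>L\<^sub>i\<^sub>+\<^sub>1, \<dots>, L\<^sub>n\<close>, sizes compare lexicographically and the greedy choice of layers is
  optimal.\<close>

section \<open>Sumsets and disjoint zero-sum parts\<close>

definition sumset_mod :: "int \<Rightarrow> int set \<Rightarrow> int set \<Rightarrow> int set" where
  "sumset_mod N A B = {(a + b) mod N | a b. a \<in> A \<and> b \<in> B}"

lemma finite_sumset_mod: "finite A \<Longrightarrow> finite B \<Longrightarrow> finite (sumset_mod N A B)"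
  by (rule finite_subset[of _ "(\<lambda>(a, b). (a + b) mod N) ` (A \<times> B)"])
    (auto simp: sumset_mod_def)

text \<open>For even \<open>b\<close>, halve both \<open>b\<close> and the modulus; for odd
  \<open>b\<close>, the multiplier \<open>2 ^ l\<close> works, because an odd multiple of half the
  modulus is congruent to that half.\<close>

lemma ex_multiple_eq_half:
  fixes b :: int
  assumes "0 < b" "b < 2 ^ Suc l"
  shows "\<exists>k::nat. int k * b mod 2 ^ Suc l = 2 ^ l"
  using assms
proof (induction l arbitrary: b)
  case 0
  then have "b = 1" by simp
  then show ?case by (intro exI[of _ 1]) simp
next
  case (Suc l)
  show ?case
  proof (cases "even b")
    case True
    then obtain c where c: "b = 2 * c" by (elim evenE)
    from Suc.prems c have "0 < c" "c < 2 ^ Suc l" by auto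
    from Suc.IH[OF this] obtain k where "int k * c mod 2 ^ Suc l = 2 ^ l" by blast
    then have "int k * b mod 2 ^ Suc (Suc l) = 2 ^ Suc l"
      using mult_mod_right[of 2 "int k * c" "2 ^ Suc l"] by (simp add: c algebra_simps)
    then show ?thesis by blast
  next
    case False
    then obtain c where c: "b = 2 * c + 1" by (elim oddE)
    have "int (2 ^ Suc l) * b = 2 ^ Suc l + c * 2 ^ Suc (Suc l)"
      by (simp add: c algebra_simps)
    then have "int (2 ^ Suc l) * b mod 2 ^ Suc (Suc l) = 2 ^ Suc l mod 2 ^ Suc (Suc l)"
      by (metis mod_mult_self1)
    also have "\<dots> = 2 ^ Suc l" by (intro mod_pos_pos_trivial) auto
    finally show ?thesis by blast
  qed
qed

text \<open>A weak form of Kneser's theorem. Every non-trivial subgroup of the cyclic group of order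
  \<open>2 ^ Suc l\<close> contains \<open>2 ^ l\<close>, so a sumset that omits \<open>2 ^ l\<close> has no non-trivial period, and
  Dyson's transform shrinks \<open>B\<close> until it is trivial.\<close>

lemma card_sumset_mod_ge:
  fixes A B :: "int set"
  assumes "A \<subseteq> {0..<2 ^ Suc l}" "B \<subseteq> {0..<2 ^ Suc l}" "0 \<in> A" "0 \<in> B"
    and "2 ^ l \<notin> sumset_mod (2 ^ Suc l) A B"
  shows "card A + card B \<le> card (sumset_mod (2 ^ Suc l) A B) + 1"
  using assms
proof (induction "card B" arbitrary: A B rule: less_induct)
  case less
  define N :: int where "N = 2 ^ Suc l"
  have N: "N > 0" by (simp add: N_def)
  note prems = less.prems[folded N_def]
  have finA: "finite A" and finB: "finite B"
    using prems(1,2) finite_subset[of _ "{0..<N}"] by auto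
  have Amod: "a mod N = a" if "a \<in> A" for a using prems(1) that by (intro mod_pos_pos_trivial) auto
  have Bmod: "b mod N = b" if "b \<in> B" for b using prems(2) that by (intro mod_pos_pos_trivial) auto
  show ?case
  proof (cases "\<exists>e\<in>A. \<exists>b\<in>B. (b + e) mod N \<notin> A")
    case True
    then obtain e b0 where e: "e \<in> A" "b0 \<in> B" "(b0 + e) mod N \<notin> A" by blast
    \<comment> \<open>Dyson's transform at \<open>e\<close>: the translate \<open>B + e\<close> is
      merged into \<open>A\<close>, and \<open>B'\<close> keeps those elements whose translate was
      already in \<open>A\<close>, so the total size is unchanged. The element \<open>b0\<close>
      makes the shrinking strict.\<close>
    define Be where "Be = (\<lambda>b. (b + e) mod N) ` B"
    have inj: "inj_on (\<lambda>b. (b + e) mod N) B"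
    proof (rule inj_onI)
      fix x y assume "x \<in> B" "y \<in> B" "(x + e) mod N = (y + e) mod N"
      then have "x mod N = y mod N" by (simp add: mod_eq_dvd_iff)
      with \<open>x \<in> B\<close> \<open>y \<in> B\<close> Bmod show "x = y" by simp
    qed
    define B' where "B' = {b \<in> B. (b + e) mod N \<in> A}"
    define A' where "A' = A \<union> Be"
    have imB': "(\<lambda>b. (b + e) mod N) ` B' = A \<inter> Be"
      by (auto simp: B'_def Be_def)
    have "inj_on (\<lambda>b. (b + e) mod N) B'" by (rule inj_on_subset[OF inj]) (auto simp: B'_def)
    then have "card B' = card (A \<inter> Be)" by (metis card_image imB')
    moreover have "card B = card Be" by (simp add: Be_def card_image inj)
    moreover have "card A + card Be = card A' + card (A \<inter> Be)"
      unfolding A'_def using finA finB by (intro card_Un_Int) (auto simp: Be_def)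
    ultimately have cards: "card A + card B = card A' + card B'" by simp
    have "B' \<subset> B" using e by (auto simp: B'_def)
    then have less': "card B' < card B" using finB by (intro psubset_card_mono)
    have sub: "sumset_mod N A' B' \<subseteq> sumset_mod N A B"
    proof
      fix x assume "x \<in> sumset_mod N A' B'"
      then obtain a b where ab: "a \<in> A'" "b \<in> B'" "x = (a + b) mod N"
        by (auto simp: sumset_mod_def)
      show "x \<in> sumset_mod N A B"
      proof (cases "a \<in> A")
        case True
        then show ?thesis using ab by (auto simp: sumset_mod_def B'_def)
      next
        case False
        then obtain c where c: "c \<in> B" "a = (c + e) mod N" using ab by (auto simp: A'_def Be_def)
        \<comment> \<open>The shift by \<open>e\<close> moves from \<open>c\<close> to
          \<open>b\<close>, which turns the sum back into one of an element of \<open>A\<close> and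
          an element of \<open>B\<close>.\<close>
        have "x = ((b + e) mod N + c) mod N"
          unfolding ab c by (simp add: mod_simps algebra_simps)
        moreover have "(b + e) mod N \<in> A" using ab by (simp add: B'_def)
        ultimately show ?thesis using c by (auto simp: sumset_mod_def)
      qed
    qed
    have "card A' + card B' \<le> card (sumset_mod N A' B') + 1"
      unfolding N_def
    proof (rule less.hyps[OF less'])
      show "A' \<subseteq> {0..<2 ^ Suc l}" using prems(1) N unfolding A'_def Be_def N_def[symmetric] by auto
      show "B' \<subseteq> {0..<2 ^ Suc l}" using less.prems(2) by (auto simp: B'_def)
      show "0 \<in> A'" "0 \<in> B'" using prems Amod e by (auto simp: A'_def B'_def)
      show "2 ^ l \<notin> sumset_mod (2 ^ Suc l) A' B'" using sub prems(5) by (auto simp: N_def)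
    qed
    also have "card (sumset_mod N A' B') \<le> card (sumset_mod N A B)"
      using sub finA finB finite_sumset_mod by (intro card_mono) auto
    finally show ?thesis using cards by (simp add: N_def)
  next
    case False
    \<comment> \<open>No transform shrinks \<open>B\<close>, so \<open>A\<close> is closed under
      adding elements of \<open>B\<close>. Starting from 0, it therefore contains every multiple of
      any \<open>b\<close> in \<open>B\<close>, among them \<open>2 ^ l\<close> if \<open>b\<close>
      is non-zero.\<close>
    have "B = {0}"
    proof (rule ccontr)
      assume "B \<noteq> {0}"
      then obtain b where b: "b \<in> B" "b \<noteq> 0" using prems(4) by blast
      have mult: "int k * b mod N \<in> A" for k
      proof (induction k)
        case (Suc k)
        then have "(b + int k * b mod N) mod N \<in> A" using False b by blast
        then show ?case by (simp add: mod_simps algebra_simps)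
      qed (use prems in simp)
      have "0 < b" "b < 2 ^ Suc l" using b less.prems(2) by force+
      from ex_multiple_eq_half[OF this] obtain k where "int k * b mod N = 2 ^ l"
        unfolding N_def by blast
      then have "2 ^ l \<in> A" using mult[of k] by simp
      then have "(2 ^ l + 0) mod N \<in> sumset_mod N A B"
        using prems unfolding sumset_mod_def by blast
      then show False using prems(5) Amod[OF \<open>2 ^ l \<in> A\<close>] by simp
    qed
    moreover have "sumset_mod N A {0} = A" using Amod by (force simp: sumset_mod_def)
    ultimately show ?thesis by (simp add: N_def)
  qed
qed

section \<open>Partial sums and the extraction of zero-sum parts\<close>

lemma subset_mset_add_mset: "T \<subseteq># S \<Longrightarrow> T \<subseteq># add_mset a S"
  using subset_mset.add_increasing2[of "{#a#}" T S] by simp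

definition zero_sum_free :: "int \<Rightarrow> int multiset \<Rightarrow> bool" where
  "zero_sum_free N S \<longleftrightarrow> (\<forall>T. T \<subseteq># S \<longrightarrow> T \<noteq> {#} \<longrightarrow> \<not> N dvd sum_mset T)"

text \<open>Modelled on the set \<open>P\<close> of partial sums of a sequence: differences are sums of blocks, up to sign.\<close>

definition difference_closed :: "int \<Rightarrow> int multiset \<Rightarrow> int set \<Rightarrow> bool" where
  "difference_closed N S P \<longleftrightarrow> 0 \<in> P \<and> P \<subseteq> {0..<N} \<and>
     (\<forall>x\<in>P. \<exists>T. T \<subseteq># S \<and> N dvd x - sum_mset T) \<and>
     (\<forall>x\<in>P. \<forall>y\<in>P. \<exists>T. T \<subseteq># S \<and> (N dvd x - y - sum_mset T \<or> N dvd y - x - sum_mset T))"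

text \<open>Take the partial sums of an enumeration of \<open>S\<close>. Appending \<open>a\<close>
  adds the new total \<open>s\<close>. Each old \<open>x\<close> is the sum of some
  \<open>T\<close>, so \<open>s - x\<close> is the sum of the complement of \<open>T\<close>
  together with \<open>a\<close>. That block is non-empty, hence zero-sum freeness makes
  \<open>s\<close> different from all old elements.\<close>

lemma zero_sum_free_difference_closed:
  assumes "zero_sum_free N S" and N: "N > 0"
  shows "\<exists>P. difference_closed N S P \<and> card P = size S + 1"
  using assms(1)
proof (induction S)
  case empty
  have "difference_closed N {#} {0}" using N by (auto simp: difference_closed_def)
  then show ?case by (intro exI[of _ "{0}"]) auto
next
  case (add a S)
  have "zero_sum_free N S"
    using add.prems by (auto simp: zero_sum_free_def intro: subset_mset_add_mset)
  then obtain P where P: "difference_closed N S P" "card P = size S + 1" using add.IH by blast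
  define s where "s = (sum_mset S + a) mod N"
  have sdvd: "N dvd s - (sum_mset S + a)" by (simp add: s_def mod_eq_dvd_iff[symmetric])
  have new: "\<exists>T. T \<subseteq># add_mset a S \<and> T \<noteq> {#} \<and> N dvd s - x - sum_mset T" if "x \<in> P" for x
  proof -
    from that P obtain T where T: "T \<subseteq># S" "N dvd x - sum_mset T"
      by (auto simp: difference_closed_def)
    obtain U where U: "S = T + U" using T(1) by (auto simp: mset_subset_eq_exists_conv)
    have "s - x - sum_mset (add_mset a U) = (s - (sum_mset S + a)) - (x - sum_mset T)"
      by (simp add: U)
    then have "N dvd s - x - sum_mset (add_mset a U)" using sdvd T(2) dvd_diff by metis
    moreover have "add_mset a U \<subseteq># add_mset a S" by (simp add: U)
    ultimately show ?thesis by (intro exI[of _ "add_mset a U"]) simp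
  qed
  have notin: "s \<notin> P"
  proof
    assume "s \<in> P"
    from new[OF this] add.prems show False by (auto simp: zero_sum_free_def)
  qed
  have finP: "finite P" using P finite_subset[of P "{0..<N}"] by (auto simp: difference_closed_def)
  have "difference_closed N (add_mset a S) (insert s P)"
    unfolding difference_closed_def
  proof (intro conjI ballI)
    show "0 \<in> insert s P" using P by (simp add: difference_closed_def)
    show "insert s P \<subseteq> {0..<N}" using P N by (auto simp: difference_closed_def s_def)
    fix x assume x: "x \<in> insert s P"
    show "\<exists>T. T \<subseteq># add_mset a S \<and> N dvd x - sum_mset T"
    proof (cases "x = s")
      case True
      then show ?thesis using sdvd by (intro exI[of _ "add_mset a S"]) (simp add: add.commute)
    next
      case False
      then obtain T where "T \<subseteq># S" "N dvd x - sum_mset T"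
        using x P by (auto simp: difference_closed_def)
      then show ?thesis by (intro exI[of _ T]) (simp add: subset_mset_add_mset)
    qed
    fix y assume y: "y \<in> insert s P"
    show "\<exists>T. T \<subseteq># add_mset a S \<and> (N dvd x - y - sum_mset T \<or> N dvd y - x - sum_mset T)"
    proof (cases "x = s"; cases "y = s")
      assume "x = s" "y = s"
      then show ?thesis by (intro exI[of _ "{#}"]) simp
    next
      assume "x = s" "y \<noteq> s"
      then show ?thesis using y new by auto
    next
      assume "x \<noteq> s" "y = s"
      then show ?thesis using x new by auto
    next
      assume "x \<noteq> s" "y \<noteq> s"
      then have "x \<in> P" "y \<in> P" using x y by auto
      then obtain T where "T \<subseteq># S" "N dvd x - y - sum_mset T \<or> N dvd y - x - sum_mset T"
        using P(1) unfolding difference_closed_def by blast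
      then show ?thesis by (intro exI[of _ T]) (simp add: subset_mset_add_mset)
    qed
  qed
  moreover have "card (insert s P) = size (add_mset a S) + 1" using P finP notin by simp
  ultimately show ?case by blast
qed

text \<open>Choose a non-empty zero-sum part of least size. Removing any one element leaves a
  zero-sum free rest, since a zero-sum part of the rest would be smaller.\<close>

lemma obtain_minimal_zero_sum:
  assumes "\<not> zero_sum_free N S"
  obtains a T where "add_mset a T \<subseteq># S" "N dvd sum_mset (add_mset a T)" "zero_sum_free N T"
proof -
  define Q where "Q T \<longleftrightarrow> T \<subseteq># S \<and> T \<noteq> {#} \<and> N dvd sum_mset T" for T
  have "\<exists>T. Q T" using assms by (auto simp: zero_sum_free_def Q_def)
  then obtain M where M: "Q M" "\<And>T. Q T \<Longrightarrow> size M \<le> size T"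
    using ex_has_least_nat[of Q _ size] by blast
  from M(1) obtain a T where aT: "M = add_mset a T" by (metis Q_def multiset_cases)
  have "zero_sum_free N T"
    unfolding zero_sum_free_def
  proof (intro allI impI notI)
    fix U assume U: "U \<subseteq># T" "U \<noteq> {#}" "N dvd sum_mset U"
    have "T \<subseteq># S" using M(1) unfolding aT Q_def by (metis mset_subset_eq_insertD subset_mset.less_imp_le)
    then have "Q U" using U subset_mset.order_trans by (auto simp: Q_def)
    then show False using M(2)[of U] size_mset_mono[OF U(1)] aT by simp
  qed
  then show thesis using that M(1) aT by (auto simp: Q_def)
qed

text \<open>Splitting off a minimal zero-sum part \<open>add_mset a T\<close> provides a set
  \<open>P0\<close> with exactly as many elements as that part. Adding it to the set of the
  remaining elements loses at most one in cardinality, and this loss is paid for by the additional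
  member of \<open>G\<close>.\<close>

lemma disjoint_zero_sums_difference_closed:
  fixes S :: "int multiset"
  assumes "\<And>T. T \<subseteq># S \<Longrightarrow> sum_mset T mod 2 ^ Suc l \<noteq> 2 ^ l"
  shows "\<exists>G P. \<Sum>\<^sub># G \<subseteq># S \<and> (\<forall>g\<in>#G. g \<noteq> {#} \<and> 2 ^ Suc l dvd sum_mset g) \<and>
           difference_closed (2 ^ Suc l) S P \<and> size S + 1 \<le> card P + size G"
  using assms
proof (induction "size S" arbitrary: S rule: less_induct)
  case less
  define N :: int where "N = 2 ^ Suc l"
  have N: "N > 0" by (simp add: N_def)
  show ?case
  proof (cases "zero_sum_free N S")
    case True
    from zero_sum_free_difference_closed[OF this N] obtain P
      where "difference_closed N S P" "card P = size S + 1" by blast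
    then show ?thesis by (intro exI[of _ "{#}"] exI[of _ P]) (auto simp: N_def)
  next
    case False
    then obtain a T where aT: "add_mset a T \<subseteq># S" "N dvd sum_mset (add_mset a T)" "zero_sum_free N T"
      by (rule obtain_minimal_zero_sum)
    then obtain S' where S': "S = add_mset a T + S'" by (auto simp: mset_subset_eq_exists_conv)
    have "sum_mset U mod 2 ^ Suc l \<noteq> 2 ^ l" if "U \<subseteq># S'" for U
      using less.prems[of U] that S' mset_subset_eq_add_right subset_mset.order_trans by metis
    with less.hyps[of S'] S' obtain G P' where
      G: "\<Sum>\<^sub># G \<subseteq># S'" "\<forall>g\<in>#G. g \<noteq> {#} \<and> N dvd sum_mset g" and
      P': "difference_closed N S' P'" "size S' + 1 \<le> card P' + size G"
      unfolding N_def by auto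
    from zero_sum_free_difference_closed[OF aT(3) N] obtain P0 where
      P0: "difference_closed N T P0" "card P0 = size T + 1" by blast
    define P where "P = sumset_mod N P0 P'"
    have sums: "\<exists>U. U \<subseteq># S \<and> N dvd x - sum_mset U" if xP: "x \<in> P" for x
    proof -
      from xP obtain p p' where p: "p \<in> P0" "p' \<in> P'" "x = (p + p') mod N"
        by (auto simp: P_def sumset_mod_def)
      from P0 p(1) obtain U where U: "U \<subseteq># T" "N dvd p - sum_mset U" by (auto simp: difference_closed_def)
      from P' p(2) obtain U' where U': "U' \<subseteq># S'" "N dvd p' - sum_mset U'" by (auto simp: difference_closed_def)
      have "N dvd x - (p + p')" by (simp add: p mod_eq_dvd_iff[symmetric])
      then have "N dvd (x - (p + p')) + (p - sum_mset U) + (p' - sum_mset U')"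
        using U U' by (intro dvd_add)
      then have "N dvd x - sum_mset (U + U')" by (simp add: algebra_simps)
      moreover have "U + U' \<subseteq># S" unfolding S'
        using U(1) U'(1) by (intro subset_mset.add_mono subset_mset_add_mset)
      ultimately show ?thesis by blast
    qed
    \<comment> \<open>Inside a zero-sum part the sign ambiguity disappears: the complement
      \<open>V\<close> of \<open>U\<close> has the opposite sum modulo \<open>N\<close>.\<close>
    have T_sym: "\<exists>U. U \<subseteq># add_mset a T \<and> N dvd p - q - sum_mset U" if "p \<in> P0" "q \<in> P0" for p q
    proof -
      from P0 that obtain U where U: "U \<subseteq># T" "N dvd p - q - sum_mset U \<or> N dvd q - p - sum_mset U"
        unfolding difference_closed_def by blast
      then have sub: "U \<subseteq># add_mset a T"
        by (simp add: subset_mset_add_mset)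
      show ?thesis
      proof (cases "N dvd p - q - sum_mset U")
        case True
        then show ?thesis using sub by blast
      next
        case False
        then have *: "N dvd q - p - sum_mset U" using U by simp
        obtain V where V: "add_mset a T = U + V" using sub by (auto simp: mset_subset_eq_exists_conv)
        have "p - q - sum_mset V = - (q - p - sum_mset U) - sum_mset (add_mset a T)"
          unfolding V by simp
        then have "N dvd p - q - sum_mset V" using * aT(2) by (metis dvd_diff dvd_minus_iff)
        moreover have "V \<subseteq># add_mset a T" by (simp add: V)
        ultimately show ?thesis by blast
      qed
    qed
    \<comment> \<open>The difference coming from \<open>S'\<close> has a definite sign in only one
      orientation; by \<open>T_sym\<close> the difference coming from \<open>P0\<close> can follow
      that orientation, so the two blocks can be joined.\<close>
    have half: "\<exists>U. U \<subseteq># S \<and> N dvd (p + p') - (q + q') - sum_mset U"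
      if pq: "p \<in> P0" "q \<in> P0" "U' \<subseteq># S'" "N dvd p' - q' - sum_mset U'" for p q p' q' U'
    proof -
      from T_sym[OF pq(1,2)] obtain U where U: "U \<subseteq># add_mset a T" "N dvd p - q - sum_mset U" by blast
      have "N dvd (p - q - sum_mset U) + (p' - q' - sum_mset U')" using U(2) pq(4) by (rule dvd_add)
      then have "N dvd (p + p') - (q + q') - sum_mset (U + U')" by (simp add: algebra_simps)
      moreover have "U + U' \<subseteq># S" unfolding S' using U(1) pq(3) by (rule subset_mset.add_mono)
      ultimately show ?thesis by blast
    qed
    have diffs: "\<exists>U. U \<subseteq># S \<and> (N dvd x - y - sum_mset U \<or> N dvd y - x - sum_mset U)"
      if xy: "x \<in> P" "y \<in> P" for x y
    proof -
      from xy(1) obtain p p' where p: "p \<in> P0" "p' \<in> P'" "x = (p + p') mod N"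
        by (auto simp: P_def sumset_mod_def)
      from xy(2) obtain q q' where q: "q \<in> P0" "q' \<in> P'" "y = (q + q') mod N"
        by (auto simp: P_def sumset_mod_def)
      have red: "N dvd x - y - u \<longleftrightarrow> N dvd (p + p') - (q + q') - u"
        "N dvd y - x - u \<longleftrightarrow> N dvd (q + q') - (p + p') - u" for u
        unfolding p q dvd_eq_mod_eq_0 by (metis mod_diff_eq mod_diff_left_eq)+
      from P' p q obtain U' where "U' \<subseteq># S'" "N dvd p' - q' - sum_mset U' \<or> N dvd q' - p' - sum_mset U'"
        unfolding difference_closed_def by blast
      then show ?thesis unfolding red using half p(1) q(1) by meson
    qed
    have closed: "difference_closed N S P"
      unfolding difference_closed_def
    proof (intro conjI ballI)
      have "(0 + 0) mod N \<in> P"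
        using P0 P' unfolding P_def sumset_mod_def difference_closed_def by blast
      then show "0 \<in> P" by simp
      show "P \<subseteq> {0..<N}" using N by (auto simp: P_def sumset_mod_def)
    qed (use sums diffs in auto)
    have "2 ^ l \<notin> P"
    proof
      assume "2 ^ l \<in> P"
      from sums[OF this] obtain U where U: "U \<subseteq># S" "N dvd 2 ^ l - sum_mset U" by blast
      then have "2 ^ l mod N = sum_mset U mod N" by (simp add: mod_eq_dvd_iff)
      moreover have "2 ^ l mod N = 2 ^ l" by (intro mod_pos_pos_trivial) (auto simp: N_def)
      ultimately show False using less.prems[OF U(1)] by (simp add: N_def)
    qed
    then have "card P0 + card P' \<le> card P + 1"
      using P0 P' unfolding P_def N_def difference_closed_def by (intro card_sumset_mod_ge) auto
    then have "size S + 1 \<le> card P + size (add_mset (add_mset a T) G)"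
      using P0(2) P'(2) by (simp add: S')
    moreover have "\<Sum>\<^sub># (add_mset (add_mset a T) G) \<subseteq># S"
      using G(1) by (simp add: S')
    moreover have "\<forall>g\<in>#add_mset (add_mset a T) G. g \<noteq> {#} \<and> N dvd sum_mset g"
      using G(2) aT(2) by auto
    ultimately show ?thesis using closed unfolding N_def by blast
  qed
qed

text \<open>Distinct elements of \<open>P\<close> that agree modulo \<open>2 ^ l\<close> differ by
  exactly \<open>2 ^ l\<close> up to sign. Modulo \<open>2 ^ Suc l\<close> both signs give
  \<open>2 ^ l\<close>, so the sign ambiguity is harmless and some subset sum would be the excluded
  one. Hence \<open>P\<close> injects into the residues modulo \<open>2 ^ l\<close>.\<close>

lemma disjoint_zero_sums:
  fixes S :: "int multiset"
  assumes avoid: "\<And>T. T \<subseteq># S \<Longrightarrow> sum_mset T mod 2 ^ Suc l \<noteq> 2 ^ l"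
  obtains G where "\<Sum>\<^sub># G \<subseteq># S" "\<forall>g\<in>#G. g \<noteq> {#} \<and> 2 ^ Suc l dvd sum_mset g"
    "size S + 1 \<le> 2 ^ l + size G"
proof -
  obtain G P where G: "\<Sum>\<^sub># G \<subseteq># S" "\<forall>g\<in>#G. g \<noteq> {#} \<and> 2 ^ Suc l dvd sum_mset g"
    and P: "difference_closed (2 ^ Suc l) S P" "size S + 1 \<le> card P + size G"
    using disjoint_zero_sums_difference_closed[OF avoid] by blast
  have "inj_on (\<lambda>x. x mod 2 ^ l) P"
  proof (rule inj_onI, rule ccontr)
    fix x y assume xy: "x \<in> P" "y \<in> P" "x mod 2 ^ l = y mod 2 ^ l" "x \<noteq> y"
    have half: "u mod 2 ^ Suc l = 2 ^ l"
      if "u = v - w" "v \<in> P" "w \<in> P" "v mod 2 ^ l = w mod 2 ^ l" "v \<noteq> w" for u v w :: int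
    proof -
      have "2 ^ l dvd u" using that by (simp add: mod_eq_dvd_iff)
      then obtain c where c: "u = 2 ^ l * c" by (elim dvdE)
      have r: "0 \<le> v" "v < 2 ^ Suc l" "0 \<le> w" "w < 2 ^ Suc l"
        using P(1) that by (auto simp: difference_closed_def)
      have "\<bar>u\<bar> < 2 ^ l * 2" using r that(1) by (simp add: algebra_simps)
      then have "\<bar>c\<bar> < 2" by (simp add: c abs_mult)
      moreover have "c \<noteq> 0" using that c by auto
      ultimately have "c mod 2 = 1" by presburger
      moreover have "u mod 2 ^ Suc l = 2 ^ l * (c mod 2)"
        unfolding c by (metis mult_mod_right power_Suc2)
      ultimately show ?thesis by simp
    qed
    from P(1) xy obtain T where "T \<subseteq># S"
      "2 ^ Suc l dvd x - y - sum_mset T \<or> 2 ^ Suc l dvd y - x - sum_mset T"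
      unfolding difference_closed_def by blast
    moreover have "(x - y) mod 2 ^ Suc l = 2 ^ l" "(y - x) mod 2 ^ Suc l = 2 ^ l"
      using half[OF refl] xy by auto
    ultimately show False using avoid[of T] by (metis mod_eq_dvd_iff)
  qed
  moreover have "(\<lambda>x. x mod 2 ^ l) ` P \<subseteq> {0..<2 ^ l}" by auto
  ultimately have "card P \<le> card {0..<2 ^ l :: int}" by (intro card_inj_on_le) auto
  then show thesis using that[of G] G P(2) by (simp add: nat_power_eq)
qed

section \<open>Cube-freeness of the construction\<close>

declare idx.simps [simp del]

lemma idx_unfold:
  assumes "2 \<le> d"
  shows "idx d = {1..floor_log d} \<union> (\<lambda>j. j + floor_log d + 1) ` idx (d - 2 ^ floor_log d + 1)"
  using assms by (subst idx.simps) simp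

lemma idx_zero: "idx 0 = {}"
  by (subst idx.simps) simp

lemma idx_one [simp]: "idx (Suc 0) = {}"
  by (subst idx.simps) simp

lemma floor_log_ge_one: "2 \<le> d \<Longrightarrow> 1 \<le> floor_log d"
  by (subst floor_log_rec) simp_all

lemma two_le_two_power_floor_log:
  assumes "2 \<le> d"
  shows "(2::nat) \<le> 2 ^ floor_log d"
  using power_increasing[OF floor_log_ge_one[OF assms], of "2::nat"] by simp

lemma idx_two: "idx 2 = {1}"
proof -
  have "floor_log 2 = 1" using floor_log_power[of 1] by simp
  then show ?thesis by (subst idx_unfold) auto
qed

text \<open>Ensures that for \<open>d \<le> n\<close> every index of the construction names one of
  the layers 1 to \<open>n\<close>.\<close>

lemma idx_subset: "1 \<le> d \<Longrightarrow> idx d \<subseteq> {1..d}"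
proof (induction d rule: less_induct)
  case (less d)
  \<comment> \<open>The inductive bound \<open>j + l + 1 \<le> d\<close> rests on
    \<open>l + 2 \<le> 2 ^ l\<close>, which fails for \<open>l = 1\<close>; so 2 and 3 are computed
    directly.\<close>
  consider "d = 1" | "d = 2" | "d = 3" | "4 \<le> d" using less.prems by linarith
  then show ?case
  proof cases
    case 3
    have "floor_log 3 = 1" using floor_log_eqI[of 3 1] by simp
    moreover have "3 - 2 ^ 1 + 1 = (2::nat)" by simp
    ultimately have "idx 3 = {1..1} \<union> (\<lambda>j. j + 1 + 1) ` idx 2"
      using idx_unfold[of 3] by (simp only:)
    then show ?thesis by (simp add: 3 idx_two)
  next
    case 4
    define l where "l = floor_log d"
    have le: "2 ^ l \<le> d" using 4 floor_log_exp2_le[of d] by (simp add: l_def)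
    have l2: "2 \<le> l"
      using floor_log_le_iff[OF 4] floor_log_power[of 2] by (simp add: l_def)
    have pow: "l + 2 \<le> 2 ^ l"
      using l2 by (induction l rule: dec_induct) auto
    have IH: "idx (d - 2 ^ l + 1) \<subseteq> {1..d - 2 ^ l + 1}" using pow le l2 by (intro less.IH) auto
    show ?thesis
    proof
      fix i assume "i \<in> idx d"
      then consider "i \<in> {1..l}" | j where "j \<in> idx (d - 2 ^ l + 1)" "i = j + l + 1"
        using idx_unfold[of d] 4 by (auto simp: l_def)
      then show "i \<in> {1..d}"
      proof cases
        case 1
        then show ?thesis using pow le by auto
      next
        case 2
        then have "j \<le> d - 2 ^ l + 1" using IH by auto
        then show ?thesis using 2 pow le by auto
      qed
    qed
  qed (auto simp: idx_two)
qed

lemma idx_pos: "i \<in> idx d \<Longrightarrow> 1 \<le> i"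
  using idx_subset[of d] by (cases "d = 0") (auto simp: idx_zero)

section \<open>Subset sums that escape the layers of the construction\<close>

lemma obtain_subset_image_mset:
  assumes "T \<subseteq># image_mset f S"
  obtains T' where "T' \<subseteq># S" "T = image_mset f T'"
proof -
  from assms obtain U where "image_mset f S = T + U" by (auto simp: mset_subset_eq_exists_conv)
  from image_mset_eq_plusD[OF this] obtain B C where "S = B + C" "T = image_mset f B" by blast
  then show thesis by (intro that[of B]) simp_all
qed

lemma sum_mset_Union_mset: "sum_mset (\<Sum>\<^sub># G) = (\<Sum>g\<in>#G. sum_mset g)"
  by (induction G) auto

lemma Union_mset_mono: "G' \<subseteq># G \<Longrightarrow> \<Sum>\<^sub># G' \<subseteq># (\<Sum>\<^sub># G)"
  by (auto simp: mset_subset_eq_exists_conv)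

text \<open>Either some subset sum lies in layer \<open>l + 1\<close>, which the construction skips,
  or there are many disjoint parts with sums divisible by \<open>2 ^ Suc l\<close>, whose quotients
  are handled by induction. The size of \<open>S\<close> is only bounded below because the number of
  parts is only known from below.\<close>

lemma ex_subset_sum_outside_idx:
  fixes S :: "int multiset"
  assumes "1 \<le> d" "d \<le> size S"
  shows "\<exists>T. T \<subseteq># S \<and> T \<noteq> {#} \<and> (\<forall>i\<in>idx d. sum_mset T mod 2 ^ i \<noteq> 2 ^ (i - 1))"
  using assms
proof (induction d arbitrary: S rule: less_induct)
  case (less d)
  show ?case
  proof (cases "d = 1")
    case True
    then show ?thesis using less.prems by (intro exI[of _ S]) auto
  next
    case False
    then have d: "2 \<le> d" using less.prems by simp
    define l where "l = floor_log d"
    define d' where "d' = d - 2 ^ l + 1"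
    have le: "2 ^ l \<le> d" using d floor_log_exp2_le[of d] by (simp add: l_def)
    have d': "d' < d" "1 \<le> d'" using le two_le_two_power_floor_log[OF d] by (auto simp: d'_def l_def)
    have idx: "idx d = {1..l} \<union> (\<lambda>j. j + l + 1) ` idx d'"
      using idx_unfold[OF d] by (simp add: l_def d'_def)
    show ?thesis
    \<comment> \<open>The index \<open>l + 1\<close> is the gap of \<open>idx d\<close>: all later
      indices are at least \<open>l + 2\<close>, so a sum with exactly this valuation avoids every
      layer of the construction.\<close>
    proof (cases "\<exists>T. T \<subseteq># S \<and> sum_mset T mod 2 ^ Suc l = 2 ^ l")
      case True
      then obtain T where T: "T \<subseteq># S" "sum_mset T mod 2 ^ Suc l = 2 ^ l" by blast
      have "sum_mset T mod 2 ^ i \<noteq> 2 ^ (i - 1)" if "i \<in> idx d" for i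
      proof
        assume i: "sum_mset T mod 2 ^ i = 2 ^ (i - 1)"
        from that consider "1 \<le> i" "i \<le> l" | "l + 2 \<le> i"
          using idx_pos by (force simp: idx)
        then show False
        proof cases
          case 1
          have "sum_mset T mod 2 ^ i = (sum_mset T mod 2 ^ Suc l) mod 2 ^ i"
            using 1 by (intro mod_mod_cancel[symmetric] le_imp_power_dvd) simp
          also have "\<dots> = 0" unfolding T using 1 by (simp add: le_imp_power_dvd flip: dvd_eq_mod_eq_0)
          finally show False using i by simp
        next
          case 2
          have "sum_mset T mod 2 ^ Suc l = (sum_mset T mod 2 ^ i) mod 2 ^ Suc l"
            using 2 by (intro mod_mod_cancel[symmetric] le_imp_power_dvd) simp
          also have "\<dots> = 0" unfolding i
            using 2 by (simp add: le_imp_power_dvd del: power_Suc flip: dvd_eq_mod_eq_0)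
          finally show False using T(2) by simp
        qed
      qed
      moreover have "T \<noteq> {#}" using T(2) by auto
      ultimately show ?thesis using T(1) by blast
    next
      case False
      then obtain G where G: "\<Sum>\<^sub># G \<subseteq># S" "\<forall>g\<in>#G. g \<noteq> {#} \<and> 2 ^ Suc l dvd sum_mset g"
        "size S + 1 \<le> 2 ^ l + size G"
        using disjoint_zero_sums[of S l] by blast
      define R where "R = image_mset (\<lambda>g. sum_mset g div 2 ^ Suc l) G"
      \<comment> \<open>This count explains the recursion: at least
        \<open>size S + 1 - 2 ^ l\<close> parts are available, hence at least
        \<open>d - 2 ^ l + 1\<close>.\<close>
      have "d' \<le> size R" using G(3) less.prems le by (simp add: R_def d'_def)
      from less.IH[OF d' this] obtain T' where T': "T' \<subseteq># R" "T' \<noteq> {#}"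
        "\<And>j. j \<in> idx d' \<Longrightarrow> sum_mset T' mod 2 ^ j \<noteq> 2 ^ (j - 1)" by blast
      from T'(1) obtain G' where G': "G' \<subseteq># G" "T' = image_mset (\<lambda>g. sum_mset g div 2 ^ Suc l) G'"
        unfolding R_def by (rule obtain_subset_image_mset)
      define T where "T = \<Sum>\<^sub># G'"
      have G'G: "g \<in># G" if "g \<in># G'" for g using that G'(1) by (rule mset_subset_eqD[rotated])
      have "sum_mset T = (\<Sum>g\<in>#G'. 2 ^ Suc l * (sum_mset g div 2 ^ Suc l))"
        unfolding T_def sum_mset_Union_mset
        by (rule arg_cong[where f = sum_mset], rule image_mset_cong)
          (use G(2) G'G in \<open>simp del: power_Suc\<close>)
      then have sumT: "sum_mset T = 2 ^ Suc l * sum_mset T'"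
        by (simp add: G'(2) sum_mset_distrib_left)
      have "T \<subseteq># S" unfolding T_def
        using Union_mset_mono[OF G'(1)] G(1) by (rule subset_mset.order_trans)
      moreover have "T \<noteq> {#}"
      proof -
        obtain g where "g \<in># G'" using T'(2) G'(2) by (auto simp: multiset_nonemptyE)
        then show ?thesis using G(2) G'G by (auto simp: T_def)
      qed
      moreover have "sum_mset T mod 2 ^ i \<noteq> 2 ^ (i - 1)" if "i \<in> idx d" for i
      proof -
        from that consider "1 \<le> i" "i \<le> l" | j where "j \<in> idx d'" "i = j + l + 1"
          by (auto simp: idx)
        then show ?thesis
        proof cases
          case 1
          then have "2 ^ i dvd (2::int) ^ Suc l" by (intro le_imp_power_dvd) simp
          then have "sum_mset T mod 2 ^ i = 0" by (simp add: sumT del: power_Suc)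
          then show ?thesis by simp
        next
          case 2
          have pow: "(2::int) ^ i = 2 ^ Suc l * 2 ^ j" by (simp add: 2 power_add)
          have "i - 1 = Suc l + (j - 1)" using idx_pos[OF 2(1)] 2(2) by simp
          then have pow': "(2::int) ^ (i - 1) = 2 ^ Suc l * 2 ^ (j - 1)" by (simp only: power_add)
          have "sum_mset T mod 2 ^ i = 2 ^ Suc l * (sum_mset T' mod 2 ^ j)"
            by (simp only: sumT pow mult_mod_right)
          then show ?thesis using T'(3)[OF 2(1)] pow' by simp
        qed
      qed
      ultimately show ?thesis by blast
    qed
  qed
qed

section \<open>Cubes in unions of layers\<close>

text \<open>The index is one more than the 2-adic valuation of \<open>c\<close>.\<close>

lemma ex_layer_index:
  fixes c :: nat
  assumes "0 < c" "c < 2 ^ l"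
  shows "\<exists>i\<in>{1..l}. c mod 2 ^ i = 2 ^ (i - 1)"
  using assms
proof (induction l arbitrary: c)
  case (Suc l)
  show ?case
  proof (cases "even c")
    case True
    then obtain e where e: "c = 2 * e" by (elim evenE)
    then obtain i where i: "i \<in> {1..l}" "e mod 2 ^ i = 2 ^ (i - 1)" using Suc.IH[of e] Suc.prems by auto
    have "c mod 2 ^ Suc i = 2 * (e mod 2 ^ i)" by (simp add: e)
    also have "\<dots> = 2 ^ (Suc i - 1)" using i by (cases i) auto
    finally show ?thesis using i by (intro bexI[of _ "Suc i"]) auto
  next
    case False
    then show ?thesis by (intro bexI[of _ 1]) (auto simp: odd_iff_mod_2_eq_one)
  qed
qed simp

text \<open>Membership in a layer only depends on the 2-adic valuation, so here cubes are taken in the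
  integers, without reduction modulo \<open>2 ^ n\<close>.\<close>

definition has_cube :: "nat \<Rightarrow> nat set \<Rightarrow> bool" where
  "has_cube d J \<longleftrightarrow> (\<exists>S :: nat multiset. size S = d \<and>
     (\<forall>T. T \<subseteq># S \<longrightarrow> T \<noteq> {#} \<longrightarrow> (\<exists>i\<in>J. sum_mset T mod 2 ^ i = 2 ^ (i - 1))))"

text \<open>The cube consists of \<open>d\<close> ones: its sums are \<open>1, ..., d\<close>, all
  of valuation below \<open>k\<close>.\<close>

lemma has_cube_initial_segment:
  assumes "{1..k} \<subseteq> J" "d < 2 ^ k"
  shows "has_cube d J"
  unfolding has_cube_def
proof (intro exI[of _ "replicate_mset d 1"] conjI allI impI)
  fix T :: "nat multiset" assume T: "T \<subseteq># replicate_mset d 1" "T \<noteq> {#}"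
  then obtain m where m: "m \<le> d" "T = replicate_mset m 1" by (elim msubseteq_replicate_msetE)
  then have "\<exists>i\<in>{1..k}. m mod 2 ^ i = 2 ^ (i - 1)"
    using assms(2) T(2) by (intro ex_layer_index) (auto simp: Suc_le_eq intro: gr0I)
  then show "\<exists>i\<in>J. sum_mset T mod 2 ^ i = 2 ^ (i - 1)" using m assms(1) by auto
qed simp

text \<open>Combine \<open>2 ^ l - 1\<close> ones with the multiples by \<open>2 ^ Suc l\<close> of
  a cube for \<open>J'\<close>. If a sum contains a one, the number of ones alone decides its layer,
  which is among the first \<open>l\<close>; otherwise it is a sum of the second cube with its layer
  shifted by \<open>l + 1\<close>.\<close>

lemma has_cube_shift:
  assumes J: "{1..l} \<subseteq> J" "(\<lambda>j. j + l + 1) ` J' \<subseteq> J" and pos: "\<And>j. j \<in> J' \<Longrightarrow> 1 \<le> j"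
    and "has_cube e J'"
  shows "has_cube (2 ^ l - 1 + e) J"
proof -
  from assms(4) obtain S' :: "nat multiset" where S': "size S' = e"
    "\<And>T. T \<subseteq># S' \<Longrightarrow> T \<noteq> {#} \<Longrightarrow> \<exists>i\<in>J'. sum_mset T mod 2 ^ i = 2 ^ (i - 1)"
    unfolding has_cube_def by blast
  define A B where "A = replicate_mset (2 ^ l - 1) (1::nat)" and "B = image_mset ((*) (2 ^ Suc l)) S'"
  have "\<exists>i\<in>J. sum_mset T mod 2 ^ i = 2 ^ (i - 1)" if T: "T \<subseteq># A + B" "T \<noteq> {#}" for T
  proof -
    have "T \<inter># A \<subseteq># A" by simp
    then obtain m where m: "m \<le> 2 ^ l - 1" "T \<inter># A = replicate_mset m 1"
      unfolding A_def by (elim msubseteq_replicate_msetE)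
    have "T - A \<subseteq># B" using T(1) by (simp add: subset_eq_diff_conv add.commute)
    then obtain U where U: "U \<subseteq># S'" "T - A = image_mset ((*) (2 ^ Suc l)) U"
      unfolding B_def by (rule obtain_subset_image_mset)
    have Tsplit: "T = T \<inter># A + (T - A)" by (auto simp: multiset_eq_iff)
    have sumT: "sum_mset T = m + 2 ^ Suc l * sum_mset U"
      by (subst Tsplit) (simp only: m(2) U(2) sum_mset.union sum_mset_distrib_left[symmetric], simp)
    show ?thesis
    proof (cases "m = 0")
      case True
      then have "U \<noteq> {#}" using T(2) Tsplit m(2) U(2) by auto
      with S'(2)[OF U(1)] obtain j where j: "j \<in> J'" "sum_mset U mod 2 ^ j = 2 ^ (j - 1)" by blast
      have "sum_mset T mod 2 ^ (j + l + 1) = 2 ^ Suc l * (sum_mset U mod 2 ^ j)"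
      proof -
        have "(2::nat) ^ (j + l + 1) = 2 ^ Suc l * 2 ^ j" by (simp add: power_add)
        then show ?thesis by (simp only: sumT True mult_mod_right add_0)
      qed
      also have "\<dots> = 2 ^ (Suc l + (j - 1))" by (simp only: j(2) power_add)
      also have "Suc l + (j - 1) = j + l + 1 - 1" using pos[OF j(1)] by simp
      finally show ?thesis using J(2) j(1) by blast
    next
      case False
      have "m < 2 ^ l" using m(1) by (metis One_nat_def Suc_pred le_imp_less_Suc zero_less_numeral zero_less_power)
      then obtain i where i: "i \<in> {1..l}" "m mod 2 ^ i = 2 ^ (i - 1)"
        using ex_layer_index False by blast
      have "2 ^ i dvd (2::nat) ^ Suc l" using i(1) by (intro le_imp_power_dvd) auto
      then have "2 ^ i dvd 2 ^ Suc l * sum_mset U" by (rule dvd_mult2)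
      then have "sum_mset T mod 2 ^ i = m mod 2 ^ i" by (simp add: sumT mod_add_right_eq[symmetric] del: power_Suc)
      then show ?thesis using i J(1) by auto
    qed
  qed
  then show ?thesis unfolding has_cube_def
    by (intro exI[of _ "A + B"]) (auto simp: A_def B_def S'(1))
qed

section \<open>Sizes of unions of layers and optimality of the greedy choice\<close>

text \<open>For \<open>J\<close> inside \<open>{1..n}\<close> this is the cardinality of the union
  of the layers, by \<open>card_Union_layer\<close>; the optimization is carried out on index sets
  alone.\<close>

definition weight :: "nat \<Rightarrow> nat set \<Rightarrow> nat" where
  "weight n J = (\<Sum>i\<in>J. 2 ^ (n - i))"

lemma weight_tail: "k \<le> n \<Longrightarrow> weight n {k<..n} < 2 ^ (n - k)"
proof (induction rule: inc_induct)
  case (step k)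
  have "{k<..n} = insert (Suc k) {Suc k<..n}" using step by auto
  then have "weight n {k<..n} = 2 ^ (n - Suc k) + weight n {Suc k<..n}"
    by (simp add: weight_def)
  also have "\<dots> < 2 ^ (n - Suc k) + 2 ^ (n - Suc k)" using step by simp
  also have "\<dots> = 2 ^ (n - k)" using step by (simp add: Suc_diff_Suc flip: mult_2 power_Suc)
  finally show ?case .
qed (simp add: weight_def)

lemma weight_mono: "J \<subseteq> K \<Longrightarrow> finite K \<Longrightarrow> weight n J \<le> weight n K"
  unfolding weight_def by (rule sum_mono2) auto

text \<open>Layer \<open>k\<close> outweighs all later layers together, so replacing everything
  after \<open>k\<close> by \<open>k\<close> itself does not lower the weight.\<close>

lemma weight_missing_index:
  assumes "J \<subseteq> {1..n}" "k \<notin> J" "1 \<le> k" "k \<le> n"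
  shows "weight n J \<le> weight n {1..k}"
proof -
  have "weight n J \<le> weight n ({1..<k} \<union> {k<..n})"
  proof (rule weight_mono)
    show "J \<subseteq> {1..<k} \<union> {k<..n}"
    proof
      fix i assume "i \<in> J"
      moreover from this have "i \<noteq> k" using assms by blast
      ultimately show "i \<in> {1..<k} \<union> {k<..n}" using assms by auto
    qed
  qed simp
  also have "\<dots> = weight n {1..<k} + weight n {k<..n}"
    unfolding weight_def by (rule sum.union_disjoint) auto
  also have "\<dots> \<le> weight n {1..<k} + 2 ^ (n - k)" using weight_tail assms by (simp add: less_imp_le)
  also have "\<dots> = weight n (insert k {1..<k})" by (simp add: weight_def)
  also have "insert k {1..<k} = {1..k}" using assms by auto
  finally show ?thesis .
qed

text \<open>Multiplication by \<open>2 ^ (l + 1)\<close> carries the layers for exponent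
  \<open>n - (l + 1)\<close> to those for \<open>n\<close>. Hence the exponent has to vary in the
  following induction.\<close>

lemma weight_shift:
  assumes "finite J" "J \<subseteq> {1..}"
  shows "weight n ({1..l} \<union> (\<lambda>j. j + l + 1) ` J) = weight n {1..l} + weight (n - (l + 1)) J"
proof -
  have "weight n ({1..l} \<union> (\<lambda>j. j + l + 1) ` J) = weight n {1..l} + weight n ((\<lambda>j. j + l + 1) ` J)"
    unfolding weight_def using assms by (intro sum.union_disjoint) auto
  also have "weight n ((\<lambda>j. j + l + 1) ` J) = weight (n - (l + 1)) J"
    unfolding weight_def by (subst sum.reindex) (auto simp: inj_on_def intro!: sum.cong arg_cong[where f = "(^) 2"])
  finally show ?thesis .
qed

text \<open>If \<open>J\<close> misses an index up to \<open>l\<close>, then \<open>idx d\<close>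
  already wins there. Otherwise both sets contain \<open>1, ..., l\<close> and omit
  \<open>l + 1\<close>, and the comparison passes to the shifted tails, where a
  \<open>d'\<close>-cube for \<open>J'\<close> would extend to a \<open>d\<close>-cube for
  \<open>J\<close>.\<close>

lemma weight_le_weight_idx:
  assumes "1 \<le> d" "J \<subseteq> {1..n}" "idx d \<subseteq> {1..n}" "\<not> has_cube d J"
  shows "weight n J \<le> weight n (idx d)"
  using assms
proof (induction d arbitrary: n J rule: less_induct)
  case (less d)
  show ?case
  proof (cases "d = 1")
    case True
    have "J = {}"
    proof (rule ccontr)
      assume "J \<noteq> {}"
      then obtain i where i: "i \<in> J" by blast
      then have "1 \<le> i" using less.prems by auto
      have "\<exists>i\<in>J. sum_mset T mod 2 ^ i = 2 ^ (i - 1)" if "T \<subseteq># {#2 ^ (i - 1)#}" "T \<noteq> {#}" for T :: "nat multiset"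
      proof -
        have "T = {#2 ^ (i - 1)#}"
          using that mset_subset_size[of T "{#2 ^ (i - 1)#}"] by (auto simp: subset_mset.le_less)
        moreover have "(2::nat) ^ (i - 1) < 2 ^ i" using \<open>1 \<le> i\<close> by simp
        ultimately show ?thesis using i by (intro bexI[of _ i]) auto
      qed
      then have "has_cube d J" unfolding has_cube_def True by (intro exI[of _ "{#2 ^ (i - 1)#}"]) auto
      then show False using less.prems by blast
    qed
    then show ?thesis by (simp add: weight_def)
  next
    case False
    then have d: "2 \<le> d" using less.prems by simp
    define l where "l = floor_log d"
    define d' where "d' = d - 2 ^ l + 1"
    have le: "2 ^ l \<le> d" using d floor_log_exp2_le[of d] by (simp add: l_def)
    have d': "d' < d" "1 \<le> d'" using le two_le_two_power_floor_log[OF d] by (auto simp: d'_def l_def)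
    have idx: "idx d = {1..l} \<union> (\<lambda>j. j + l + 1) ` idx d'"
      using idx_unfold[OF d] by (simp add: l_def d'_def)
    have fin: "finite (idx d)" using less.prems(3) finite_subset by blast
    show ?thesis
    proof (cases "{1..l} \<subseteq> J")
      case False
      then obtain k where k: "1 \<le> k" "k \<le> l" "k \<notin> J" by (auto simp: subset_iff)
      then have "weight n J \<le> weight n {1..k}"
        using less.prems idx by (intro weight_missing_index) auto
      also have "\<dots> \<le> weight n (idx d)" using fin k by (intro weight_mono) (auto simp: idx)
      finally show ?thesis .
    next
      case True
      \<comment> \<open>Since \<open>d < 2 ^ Suc l\<close>, having all of the first
        \<open>l + 1\<close> layers would admit the cube of \<open>d\<close> ones.\<close>
      have "Suc l \<notin> J"
      proof
        assume "Suc l \<in> J"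
        then have "{1..Suc l} \<subseteq> J" using True by (auto simp: atLeastAtMostSuc_conv)
        moreover have "d < 2 ^ Suc l" using floor_log_exp2_gt[of d] by (simp add: l_def)
        ultimately show False using has_cube_initial_segment less.prems(4) by blast
      qed
      define J' where "J' = {j. 1 \<le> j \<and> j + l + 1 \<in> J}"
      have J: "J = {1..l} \<union> (\<lambda>j. j + l + 1) ` J'"
      proof (intro equalityI subsetI)
        fix i assume i: "i \<in> J"
        show "i \<in> {1..l} \<union> (\<lambda>j. j + l + 1) ` J'"
        proof (cases "i \<le> l")
          case True
          then show ?thesis using i less.prems(2) by auto
        next
          case False
          then have "l + 2 \<le> i" using i \<open>Suc l \<notin> J\<close> by (cases "i = Suc l") auto
          then have "i - (l + 1) \<in> J'" "i = (i - (l + 1)) + l + 1" using i by (auto simp: J'_def)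
          then show ?thesis by blast
        qed
      qed (use True in \<open>auto simp: J'_def\<close>)
      have J'sub: "J' \<subseteq> {1..n - (l + 1)}" using less.prems(2) by (force simp: J'_def)
      have idx'sub: "idx d' \<subseteq> {1..n - (l + 1)}" using less.prems(3) idx_pos by (force simp: idx)
      have "\<not> has_cube d' J'"
      proof
        assume "has_cube d' J'"
        then have "has_cube (2 ^ l - 1 + d') J"
          by (intro has_cube_shift[where J' = J']) (auto simp: J, auto simp: J'_def)
        moreover have "2 ^ l - 1 + d' = d" using le d by (simp add: d'_def)
        ultimately show False using less.prems(4) by simp
      qed
      from less.IH[OF d' J'sub idx'sub this]
      have "weight (n - (l + 1)) J' \<le> weight (n - (l + 1)) (idx d')" .
      moreover have "finite J'" "finite (idx d')" using J'sub idx'sub finite_subset by blast+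
      moreover have "J' \<subseteq> {1..}" "idx d' \<subseteq> {1..}" using J'sub idx'sub by auto
      ultimately show ?thesis unfolding J idx by (simp add: weight_shift del: One_nat_def)
    qed
  qed
qed

section \<open>Passage to residues modulo a power of two\<close>

lemma card_layer:
  assumes "1 \<le> i" "i \<le> n"
  shows "card (layer n i) = 2 ^ (n - i)"
proof -
  define h :: nat where "h = 2 ^ (i - 1)"
  have pi: "2 ^ i = 2 * h" using assms by (cases i) (auto simp: h_def)
  have pn: "2 ^ n = 2 * h * 2 ^ (n - i)" unfolding pi[symmetric] using assms by (simp flip: power_add)
  have h: "0 < h" by (simp add: h_def)
  \<comment> \<open>The layer consists of the odd multiples of \<open>h\<close> below
    \<open>2 ^ n\<close>.\<close>
  have "layer n i = (\<lambda>k. h + 2 * h * k) ` {..<2 ^ (n - i)}"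
  proof (intro equalityI subsetI)
    fix x assume "x \<in> layer n i"
    then have x: "x < 2 * h * 2 ^ (n - i)" "x mod (2 * h) = h" using assms by (auto simp: layer_def pn pi h_def)
    then have "x div (2 * h) < 2 ^ (n - i)" using h by (simp add: less_mult_imp_div_less mult.commute)
    moreover have "x = h + 2 * h * (x div (2 * h))" using x(2) mod_mult_div_eq[of x "2 * h"] by simp
    ultimately show "x \<in> (\<lambda>k. h + 2 * h * k) ` {..<2 ^ (n - i)}" by blast
  next
    fix x assume "x \<in> (\<lambda>k. h + 2 * h * k) ` {..<2 ^ (n - i)}"
    then obtain k where k: "k < 2 ^ (n - i)" "x = h + 2 * h * k" by blast
    have "x < 2 * h * Suc k" using k h by simp
    also have "\<dots> \<le> 2 * h * 2 ^ (n - i)" using k by (intro mult_le_mono2) simp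
    finally have "x < 2 ^ n" by (simp add: pn)
    moreover have "x mod 2 ^ i = h" using h by (simp add: k pi)
    ultimately show "x \<in> layer n i" using assms by (simp add: layer_def h_def)
  qed
  moreover have "inj_on (\<lambda>k. h + 2 * h * k) {..<2 ^ (n - i)}" using h by (auto simp: inj_on_def)
  ultimately show ?thesis by (simp add: card_image)
qed

lemma layer_disjoint:
  assumes "1 \<le> i" "i < j" "j \<le> n"
  shows "layer n i \<inter> layer n j = {}"
proof -
  have False if x: "x mod 2 ^ i = 2 ^ (i - 1)" "x mod 2 ^ j = 2 ^ (j - 1)" for x :: nat
  proof -
    have "x mod 2 ^ i = (x mod 2 ^ j) mod 2 ^ i"
      using assms by (subst mod_mod_cancel) (auto intro: le_imp_power_dvd)
    also have "\<dots> = 0" using assms by (simp add: x(2) le_imp_power_dvd flip: dvd_eq_mod_eq_0)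
    finally show False using x(1) by simp
  qed
  then show ?thesis using assms by (auto simp: layer_def)
qed

lemma card_Union_layer:
  assumes "J \<subseteq> {1..n}"
  shows "card (\<Union>i\<in>J. layer n i) = weight n J"
proof -
  have "card (\<Union>i\<in>J. layer n i) = (\<Sum>i\<in>J. card (layer n i))"
  proof (rule card_UN_disjoint)
    show "finite J" using assms finite_subset by blast
    show "\<forall>i\<in>J. finite (layer n i)" by (auto simp: layer_def)
    show "\<forall>i\<in>J. \<forall>j\<in>J. i \<noteq> j \<longrightarrow> layer n i \<inter> layer n j = {}"
    proof (intro ballI impI)
      fix i j assume "i \<in> J" "j \<in> J" "i \<noteq> j"
      moreover from this have "1 \<le> i" "i \<le> n" "1 \<le> j" "j \<le> n" using assms by auto
      ultimately show "layer n i \<inter> layer n j = {}"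
        using layer_disjoint[of i j n] layer_disjoint[of j i n]
        by (cases i j rule: linorder_cases) (auto simp: Int_commute)
    qed
  qed
  also have "\<dots> = weight n J" unfolding weight_def using assms by (intro sum.cong) (auto intro!: card_layer)
  finally show ?thesis .
qed

text \<open>Reduction modulo \<open>2 ^ n\<close> does not affect residues modulo
  \<open>2 ^ i\<close> for \<open>i \<le> n\<close>. This links cubes of residues to the arguments
  about unreduced sums.\<close>

lemma mod_in_Union_layer_iff:
  assumes "J \<subseteq> {1..n}"
  shows "x mod 2 ^ n \<in> (\<Union>i\<in>J. layer n i) \<longleftrightarrow> (\<exists>i\<in>J. x mod 2 ^ i = 2 ^ (i - 1))"
proof -
  have "x mod 2 ^ n mod 2 ^ i = x mod 2 ^ i" if "i \<in> J" for i
    using assms that by (intro mod_mod_cancel le_imp_power_dvd) auto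
  then show ?thesis using assms by (force simp: layer_def)
qed

lemma sum_mset_image_mod: "(\<Sum>x\<in>#T. x mod m) mod m = sum_mset T mod (m::nat)"
proof (induction T)
  case (add a T)
  then show ?case using mod_add_cong[of "a mod m" m a "\<Sum>x\<in>#T. x mod m" "sum_mset T"] by simp
qed simp

lemma cube_free_imp_not_has_cube:
  assumes J: "J \<subseteq> {1..n}" and free: "cube_free n d (\<Union>i\<in>J. layer n i)"
  shows "\<not> has_cube d J"
proof
  assume "has_cube d J"
  then obtain S :: "nat multiset" where S: "size S = d"
    "\<And>T. T \<subseteq># S \<Longrightarrow> T \<noteq> {#} \<Longrightarrow> \<exists>i\<in>J. sum_mset T mod 2 ^ i = 2 ^ (i - 1)"
    unfolding has_cube_def by blast
  define R where "R = image_mset (\<lambda>x. x mod 2 ^ n) S"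
  have "proj_cube n R \<subseteq> (\<Union>i\<in>J. layer n i)"
  proof
    fix x assume "x \<in> proj_cube n R"
    then obtain T where T: "x = sum_mset T mod 2 ^ n" "T \<subseteq># R" "T \<noteq> {#}"
      by (auto simp: proj_cube_def)
    from T(2) obtain U where U: "U \<subseteq># S" "T = image_mset (\<lambda>x. x mod 2 ^ n) U"
      unfolding R_def by (rule obtain_subset_image_mset)
    have "x = sum_mset U mod 2 ^ n" by (simp add: T(1) U(2) sum_mset_image_mod)
    moreover have "U \<noteq> {#}" using T(3) U(2) by auto
    ultimately show "x \<in> (\<Union>i\<in>J. layer n i)"
      using S(2)[OF U(1)] mod_in_Union_layer_iff[OF J] by blast
  qed
  moreover have "size R = d" "set_mset R \<subseteq> {..<2 ^ n}" by (auto simp: R_def S(1))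
  ultimately show False using free unfolding cube_free_def by blast
qed

text \<open>Copies of 0 generate no sum other than 0. This rules out layer \<open>n + 1\<close>,
  which \<open>weight\<close> does not measure.\<close>

lemma zero_notin_cube_free:
  assumes "cube_free n d A"
  shows "0 \<notin> A"
proof
  assume "0 \<in> A"
  have "proj_cube n (replicate_mset d 0) \<subseteq> A"
  proof
    fix x assume "x \<in> proj_cube n (replicate_mset d 0)"
    then obtain T where T: "x = sum_mset T mod 2 ^ n" "T \<subseteq># replicate_mset d 0"
      unfolding proj_cube_def by blast
    from T(2) obtain m where "T = replicate_mset m 0" by (elim msubseteq_replicate_msetE)
    then show "x \<in> A" using \<open>0 \<in> A\<close> by (simp add: T(1))
  qed
  moreover have "set_mset (replicate_mset d 0) \<subseteq> {..<2 ^ n :: nat}" by auto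
  ultimately show False using assms unfolding cube_free_def by (metis size_replicate_mset)
qed

lemma cube_free_cube_constr:
  assumes "1 \<le> d" "d \<le> n"
  shows "cube_free n d (cube_constr n d)"
  unfolding cube_free_def
proof
  assume "\<exists>S. size S = d \<and> set_mset S \<subseteq> {..<2 ^ n} \<and> proj_cube n S \<subseteq> cube_constr n d"
  then obtain S where S: "size S = d" "proj_cube n S \<subseteq> cube_constr n d" by blast
  have sub: "idx d \<subseteq> {1..n}" using idx_subset[OF assms(1)] assms(2) by auto
  obtain T where T: "T \<subseteq># image_mset int S" "T \<noteq> {#}"
    "\<And>i. i \<in> idx d \<Longrightarrow> sum_mset T mod 2 ^ i \<noteq> 2 ^ (i - 1)"
    using ex_subset_sum_outside_idx[OF assms(1), of "image_mset int S"] S(1) by auto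
  from T(1) obtain U where U: "U \<subseteq># S" "T = image_mset int U" by (rule obtain_subset_image_mset)
  have sumT: "sum_mset T = int (sum_mset U)" unfolding U(2) by (induction U) auto
  have "sum_mset U mod 2 ^ n \<in> proj_cube n S" using U T(2) by (auto simp: proj_cube_def)
  then have "sum_mset U mod 2 ^ n \<in> (\<Union>i\<in>idx d. layer n i)" using S(2) by (auto simp: cube_constr_def)
  then obtain i where i: "i \<in> idx d" "sum_mset U mod 2 ^ i = 2 ^ (i - 1)"
    using mod_in_Union_layer_iff[OF sub] by blast
  then have "sum_mset T mod 2 ^ i = 2 ^ (i - 1)"
    unfolding sumT by (metis of_nat_mod of_nat_numeral of_nat_power)
  then show False using T(3)[OF i(1)] by simp
qed

theorem theorem1p10:
  fixes d n :: nat
  assumes "1 \<le> d" and "d \<le> n"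
  shows "cube_free n d (cube_constr n d) \<and>
         (\<forall>J. J \<subseteq> {1..n + 1} \<longrightarrow> cube_free n d (\<Union>i\<in>J. layer n i) \<longrightarrow>
              card (\<Union>i\<in>J. layer n i) \<le> card (cube_constr n d))"
proof (intro conjI allI impI)
  show "cube_free n d (cube_constr n d)" using assms by (rule cube_free_cube_constr)
  fix J assume J: "J \<subseteq> {1..n + 1}" and free: "cube_free n d (\<Union>i\<in>J. layer n i)"
  have "n + 1 \<notin> J" using zero_notin_cube_free[OF free] by (auto simp: layer_def)
  then have J': "J \<subseteq> {1..n}" using J by (force simp: le_Suc_eq)
  have sub: "idx d \<subseteq> {1..n}" using idx_subset[OF assms(1)] assms(2) by auto
  show "card (\<Union>i\<in>J. layer n i) \<le> card (cube_constr n d)"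
    unfolding cube_constr_def card_Union_layer[OF J'] card_Union_layer[OF sub]
    using assms(1) J' sub cube_free_imp_not_has_cube[OF J' free] by (rule weight_le_weight_idx)
qed

end
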